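(* For any fixed integer $k\ge 1$, as $n\to\infty$, $C_2(n,2k+1)>n^{k+1-o(1)}$, where $o(1)\to 0$ as $n\to\infty$.
   Context: An $r$-graph on vertex set $[n]$ is a family of distinct $r$-element subsets (edges) of $[n]$. An $r$-graph $\mathcal{H}$ is $2$-cancellative if for any $4$ distinct edges $A_1,A_2,B,C\in\mathcal{H}$ one has $A_1\cup A_2\cup B\neq A_1\cup A_2\cup C$. $C_2(n,r)$ denotes the maximum number of edges of a $2$-cancellative $r$-graph on $n$ vertices. *)

theory Defs
  imports Complex_Main
begin

definition r_graph :: "nat \<Rightarrow> nat \<Rightarrow> nat set set \<Rightarrow> bool" where
  "r_graph n r H \<longleftrightarrow> (\<forall>e\<in>H. e \<subseteq> {1..n} \<and> card e = r)"

definition two_cancellative :: "'a set set \<Rightarrow> bool" where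
  "two_cancellative H \<longleftrightarrow>
    (\<forall>A1\<in>H. \<forall>A2\<in>H. \<forall>B\<in>H. \<forall>C\<in>H.
      distinct [A1, A2, B, C] \<longrightarrow> A1 \<union> A2 \<union> B \<noteq> A1 \<union> A2 \<union> C)"

definition C2 :: "nat \<Rightarrow> nat \<Rightarrow> nat" where
  "C2 n r = Max {card H |H. r_graph n r H \<and> two_cancellative H}"

text \<open>
  The set whose maximum defines \<open>C2\<close> is finite and nonempty, so \<open>Max\<close> is meaningful here.
\<close>

lemma r_graph_subset_Pow: "r_graph n r H \<Longrightarrow> H \<subseteq> Pow {1..n}"
  by (auto simp: r_graph_def)

lemma finite_C2_set: "finite {card H |H. r_graph n r H \<and> two_cancellative H}"
proof -
  have "{card H |H. r_graph n r H \<and> two_cancellative H} \<subseteq> card ` Pow (Pow {1..n})"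
    using r_graph_subset_Pow by blast
  then show ?thesis
    by (rule finite_subset) simp
qed

lemma C2_set_nonempty: "{card H |H. r_graph n r H \<and> two_cancellative H} \<noteq> {}"
proof -
  have "r_graph n r {}" "two_cancellative ({} :: nat set set)"
    by (simp_all add: r_graph_def two_cancellative_def)
  then show ?thesis by blast
qed

end

theory Submission
  imports Defs "HOL-Computational_Algebra.Polynomial" "HOL-Library.FuncSet" "HOL-Real_Asymp.Real_Asymp"
begin

text \<open>
  A word is a \<open>d\<close>-tuple of integer polynomials of degree at most \<open>k\<close> with coefficients in
  \<open>[0, M)\<close>; its edge consists of the points \<open>(i, F(i))\<close> for \<open>i = 0, \<dots>, 2k\<close>. Two words that agree at
  more than \<open>k\<close> places are equal. In the spirit of Behrend's construction, keep only the words
  with a fixed value of \<open>\<Sum>\<^sub>i |F(i)|\<^sup>2\<close>; by pigeonhole this costs a factor \<open>O(M\<^sup>2)\<close> only.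

  Suppose \<open>A\<^sub>1 \<union> A\<^sub>2 \<union> B = A\<^sub>1 \<union> A\<^sub>2 \<union> C\<close>. Wherever \<open>B\<close> and \<open>C\<close> differ, \<open>A\<^sub>1\<close> and \<open>A\<^sub>2\<close> take the values of
  \<open>B\<close> and \<open>C\<close> in some order. There are more than \<open>k\<close> such places, so \<open>A\<^sub>1 + A\<^sub>2 = B + C\<close> everywhere.
  Comparing norms, strict convexity forces \<open>A\<^sub>1 = A\<^sub>2 = B = C\<close> at the remaining places. Thus \<open>A\<^sub>1\<close>
  agrees with \<open>B\<close> or with \<open>C\<close> at each of the \<open>2k + 1\<close> places, hence with one of them at more than
  \<open>k\<close> places, and so equals it.

  This gives about \<open>M\<^bsup>d(k+1)-2\<^esup>\<close> edges on about \<open>M\<^sup>d\<close> vertices, up to factors depending on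
  \<open>k\<close> and \<open>d\<close>; let \<open>M\<close> tend to infinity and then \<open>d\<close>.
\<close>

section \<open>Relabelling of vertices and a pigeonhole bound\<close>

lemma two_cancellative_image:
  assumes "two_cancellative H" and "\<And>e. e \<in> H \<Longrightarrow> e \<subseteq> V" and "inj_on g V"
  shows "two_cancellative ((`) g ` H)"
  unfolding two_cancellative_def
proof (intro ballI impI)
  fix A1 A2 B C
  assume "A1 \<in> (`) g ` H" "A2 \<in> (`) g ` H" "B \<in> (`) g ` H" "C \<in> (`) g ` H"
    and dist: "distinct [A1, A2, B, C]"
  then obtain a1 a2 b c where in_H: "a1 \<in> H" "a2 \<in> H" "b \<in> H" "c \<in> H"
    and img: "A1 = g ` a1" "A2 = g ` a2" "B = g ` b" "C = g ` c" by (elim imageE)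
  have "distinct [a1, a2, b, c]"
    using dist distinct_map[of "(`) g" "[a1, a2, b, c]"] unfolding img list.map by blast
  then have "a1 \<union> a2 \<union> b \<noteq> a1 \<union> a2 \<union> c"
    using assms(1) in_H unfolding two_cancellative_def by simp
  moreover have "a1 \<union> a2 \<union> b \<subseteq> V" "a1 \<union> a2 \<union> c \<subseteq> V"
    using assms(2) in_H by (simp_all add: le_sup_iff)
  ultimately have "g ` (a1 \<union> a2 \<union> b) \<noteq> g ` (a1 \<union> a2 \<union> c)"
    by (simp only: inj_on_image_eq_iff[OF assms(3)] not_False_eq_True)
  then show "A1 \<union> A2 \<union> B \<noteq> A1 \<union> A2 \<union> C" by (simp add: img image_Un)
qed

text \<open>Lets the construction use any convenient vertex set: an injection of \<open>V\<close>
  into \<open>{1..n}\<close> preserves edge sizes, the number of edges and cancellativity.\<close>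

lemma card_le_C2:
  assumes "two_cancellative H" and "\<And>e. e \<in> H \<Longrightarrow> e \<subseteq> V \<and> card e = r"
    and "finite V" and "card V \<le> n"
  shows "card H \<le> C2 n r"
proof -
  obtain g where g: "inj_on g V" "g ` V \<subseteq> {1..n}"
    using card_le_inj[of V "{1..n}"] assms(3,4) by auto
  have "r_graph n r ((`) g ` H)"
    unfolding r_graph_def
  proof (intro ballI)
    fix e' assume "e' \<in> (`) g ` H"
    then obtain e where e: "e' = g ` e" "e \<subseteq> V" "card e = r" using assms(2) by blast
    then have "card e' = r" using card_image inj_on_subset[OF g(1)] by blast
    then show "e' \<subseteq> {1..n} \<and> card e' = r" using e g(2) by blast
  qed
  moreover have "two_cancellative ((`) g ` H)"
    using two_cancellative_image[OF assms(1) _ g(1)] assms(2) by blast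
  moreover have "card ((`) g ` H) = card H"
  proof (rule card_image, rule inj_onI)
    fix x y assume "x \<in> H" "y \<in> H" "g ` x = g ` y"
    then show "x = y" using assms(2) inj_on_image_eq_iff[OF g(1), of x y] by simp
  qed
  ultimately have "card H \<in> {card H |H. r_graph n r H \<and> two_cancellative H}"
    by (intro CollectI exI[of _ "(`) g ` H"]) simp
  then show ?thesis unfolding C2_def by (rule Max_ge[OF finite_C2_set])
qed

lemma pigeonhole_fiber:
  assumes "finite A" "finite B" "B \<noteq> {}" "f ` A \<subseteq> B"
  shows "\<exists>y\<in>B. card A \<le> card B * card {x \<in> A. f x = y}"
proof (rule ccontr)
  assume "\<not> ?thesis"
  then have less: "card B * card {x \<in> A. f x = y} < card A" if "y \<in> B" for y
    using that by (meson not_le)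
  have "(\<Sum>y\<in>B. card B * card {x \<in> A. f x = y}) < (\<Sum>y\<in>B. card A)"
    by (rule sum_strict_mono[OF assms(2,3) less])
  moreover have "(\<Sum>y\<in>B. card {x \<in> A. f x = y}) = card A"
    using sum.group[OF assms(1,2,4), of "\<lambda>_. 1::nat"] by simp
  ultimately show False by (simp flip: sum_distrib_left)
qed

section \<open>Polynomial words and cancellation\<close>

definition word_eval :: "nat \<Rightarrow> (nat \<Rightarrow> int poly) \<Rightarrow> nat \<Rightarrow> nat \<Rightarrow> int" where
  "word_eval d F i = (\<lambda>l\<in>{..<d}. poly (F l) (int i))"

text \<open>The tag \<open>i\<close> makes the hypergraph \<open>(2 * k + 1)\<close>-partite: edges
  have full size even if values repeat, and two edges can only meet at equal positions.\<close>

definition word_edge :: "nat \<Rightarrow> nat \<Rightarrow> (nat \<Rightarrow> int poly) \<Rightarrow> (nat \<times> (nat \<Rightarrow> int)) set" where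
  "word_edge k d F = (\<lambda>i. (i, word_eval d F i)) ` {..2 * k}"

definition word_norm :: "nat \<Rightarrow> nat \<Rightarrow> (nat \<Rightarrow> int poly) \<Rightarrow> int" where
  "word_norm k d F = (\<Sum>i\<le>2 * k. \<Sum>l<d. (poly (F l) (int i))\<^sup>2)"

lemma mem_word_edge: "(i, v) \<in> word_edge k d F \<longleftrightarrow> i \<le> 2 * k \<and> v = word_eval d F i"
  by (auto simp: word_edge_def)

lemma card_word_edge: "card (word_edge k d F) = 2 * k + 1"
  unfolding word_edge_def by (subst card_image) (auto simp: inj_on_def)

lemma word_eval_eq_iff:
  "word_eval d F i = word_eval d G i \<longleftrightarrow> (\<forall>l<d. poly (F l) (int i) = poly (G l) (int i))"
  by (auto simp: word_eval_def fun_eq_iff restrict_def)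

lemma poly_eq_0_of_many_roots:
  fixes p :: "int poly"
  assumes "degree p \<le> k" "k < card I" "\<And>i. i \<in> I \<Longrightarrow> poly p (int i) = 0"
  shows "p = 0"
proof (rule ccontr)
  assume "p \<noteq> 0"
  have "card (int ` I) \<le> card {x. poly p x = 0}"
    using assms(3) poly_roots_finite[OF \<open>p \<noteq> 0\<close>] by (intro card_mono) auto
  also have "\<dots> \<le> k" using card_poly_roots_bound[OF \<open>p \<noteq> 0\<close>] assms(1) by simp
  finally show False using assms(2) by (simp add: card_image)
qed

locale poly_words =
  fixes k d :: nat and W :: "(nat \<Rightarrow> int poly) set"
  assumes ext: "F \<in> W \<Longrightarrow> F \<in> extensional {..<d}"
    and deg: "F \<in> W \<Longrightarrow> l < d \<Longrightarrow> degree (F l) \<le> k"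
begin

text \<open>The minimum distance argument for Reed-Solomon codes, applied in each coordinate
  \<open>l < d\<close>; extensionality settles the other indices.\<close>

lemma word_eqI:
  assumes "F \<in> W" "G \<in> W" "k < card I" "\<And>i. i \<in> I \<Longrightarrow> word_eval d F i = word_eval d G i"
  shows "F = G"
proof (rule extensionalityI)
  show "F \<in> extensional {..<d}" "G \<in> extensional {..<d}" using assms ext by auto
  fix l assume "l \<in> {..<d}"
  then have l: "l < d" by simp
  have "F l - G l = 0"
  proof (rule poly_eq_0_of_many_roots[OF _ assms(3)])
    show "degree (F l - G l) \<le> k" using assms(1,2) deg l by (intro degree_diff_le)
    show "poly (F l - G l) (int i) = 0" if "i \<in> I" for i
      using assms(4)[OF that] l by (simp add: word_eval_eq_iff)
  qed
  then show "F l = G l" by simp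
qed

lemma inj_on_word_edge: "inj_on (word_edge k d) W"
proof (rule inj_onI)
  fix F G assume FG: "F \<in> W" "G \<in> W" and eq: "word_edge k d F = word_edge k d G"
  have "word_eval d F i = word_eval d G i" if "i \<in> {..2 * k}" for i
    using mem_word_edge[of i "word_eval d F i" k d F] that eq mem_word_edge by auto
  with FG show "F = G" by (intro word_eqI[of F G "{..2 * k}"]) auto
qed

lemma two_cancellative_word_edges:
  assumes norm: "\<And>F. F \<in> W \<Longrightarrow> word_norm k d F = s"
  shows "two_cancellative (word_edge k d ` W)"
  unfolding two_cancellative_def
proof (intro ballI impI notI)
  fix E1 E2 E3 E4
  assume "E1 \<in> word_edge k d ` W" "E2 \<in> word_edge k d ` W"
    "E3 \<in> word_edge k d ` W" "E4 \<in> word_edge k d ` W"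
    and dist: "distinct [E1, E2, E3, E4]" and eq: "E1 \<union> E2 \<union> E3 = E1 \<union> E2 \<union> E4"
  then obtain A1 A2 B C where W: "A1 \<in> W" "A2 \<in> W" "B \<in> W" "C \<in> W"
    and E: "E1 = word_edge k d A1" "E2 = word_edge k d A2"
      "E3 = word_edge k d B" "E4 = word_edge k d C" by blast
  let ?v = "word_eval d"
  define D where "D = {i. i \<le> 2 * k \<and> ?v B i \<noteq> ?v C i}"
  \<comment> \<open>The point of \<open>B\<close> at position \<open>i\<close> is not in
    \<open>E4\<close>, so \<open>E1\<close> or \<open>E2\<close> must contain it; likewise for
    \<open>C\<close>. Each edge has a single point at position \<open>i\<close>, so one of them
    supplies each value.\<close>
  have D_swap: "?v A1 i = ?v B i \<and> ?v A2 i = ?v C i \<or> ?v A1 i = ?v C i \<and> ?v A2 i = ?v B i"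
    if "i \<in> D" for i
  proof -
    have i: "i \<le> 2 * k" "?v B i \<noteq> ?v C i" using that by (auto simp: D_def)
    have "(i, ?v B i) \<in> E3" "(i, ?v C i) \<in> E4" using i E by (auto simp: mem_word_edge)
    then have "(i, ?v B i) \<in> E1 \<union> E2 \<union> E4" "(i, ?v C i) \<in> E1 \<union> E2 \<union> E3" using eq by blast+
    then show ?thesis using i E by (auto simp: mem_word_edge)
  qed
  \<comment> \<open>Otherwise \<open>B\<close> and \<open>C\<close> agree at no fewer than
    \<open>k + 1\<close> of the \<open>2 * k + 1\<close> positions.\<close>
  have card_D: "k < card D"
  proof (rule ccontr)
    assume "\<not> k < card D"
    moreover have "card ({..2 * k} - D) = card {..2 * k} - card D"
      by (rule card_Diff_subset) (auto simp: D_def)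
    ultimately have "k < card ({..2 * k} - D)" by simp
    then have "B = C" using W by (intro word_eqI) (auto simp: D_def)
    with dist E show False by simp
  qed
  \<comment> \<open>Either order in \<open>D_swap\<close> gives equal sums on \<open>D\<close>; the
    degree bound then extends the identity to positions outside \<open>D\<close>.\<close>
  have sum_eq: "A1 l + A2 l = B l + C l" if l: "l < d" for l
  proof -
    have "A1 l + A2 l - (B l + C l) = 0"
    proof (rule poly_eq_0_of_many_roots[OF _ card_D])
      show "degree (A1 l + A2 l - (B l + C l)) \<le> k"
        using W l deg by (intro degree_diff_le degree_add_le) auto
      fix i assume "i \<in> D"
      from D_swap[OF this] l show "poly (A1 l + A2 l - (B l + C l)) (int i) = 0"
        by (auto simp: word_eval_eq_iff)
    qed
    then show ?thesis by simp
  qed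
  define t where "t i l = (poly (A1 l) (int i))\<^sup>2 + (poly (A2 l) (int i))\<^sup>2
    - (poly (B l) (int i))\<^sup>2 - (poly (C l) (int i))\<^sup>2" for i l
  have t_D: "t i l = 0" if "i \<in> D" "l < d" for i l
    using D_swap[OF that(1)] that(2) by (auto simp: word_eval_eq_iff t_def)
  \<comment> \<open>Parallelogram law: off \<open>D\<close> the values of \<open>B\<close> and
    \<open>C\<close> coincide, so by \<open>sum_eq\<close> they are the midpoint of those of
    \<open>A1\<close> and \<open>A2\<close>. Doubling avoids halves in the integers.\<close>
  have t_notD: "2 * t i l = (poly (A1 l) (int i) - poly (A2 l) (int i))\<^sup>2 \<and>
      2 * poly (B l) (int i) = poly (A1 l) (int i) + poly (A2 l) (int i)"
    if "i \<le> 2 * k" "i \<notin> D" "l < d" for i l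
  proof -
    define a1 a2 b where "a1 = poly (A1 l) (int i)" "a2 = poly (A2 l) (int i)" "b = poly (B l) (int i)"
    have bc: "poly (C l) (int i) = b"
      using that by (auto simp: D_def word_eval_eq_iff a1_a2_b_def)
    have s: "2 * b = a1 + a2"
      using arg_cong[OF sum_eq[OF that(3)], of "\<lambda>p. poly p (int i)"] bc by (simp add: a1_a2_b_def)
    have "2 * (a1\<^sup>2 + a2\<^sup>2 - b\<^sup>2 - b\<^sup>2) = 2 * a1\<^sup>2 + 2 * a2\<^sup>2 - (2 * b)\<^sup>2"
      by (simp add: power2_eq_square)
    also have "\<dots> = (a1 - a2)\<^sup>2"
      unfolding s by (simp add: power2_eq_square algebra_simps)
    finally show ?thesis using s bc unfolding t_def by (simp add: a1_a2_b_def)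
  qed
  have t_nonneg: "t i l \<ge> 0" if "i \<le> 2 * k" "l < d" for i l
  proof (cases "i \<in> D")
    case True
    with t_D that show ?thesis by simp
  next
    case False
    then have "2 * t i l \<ge> 0" using t_notD that by (metis zero_le_power2)
    then show ?thesis by simp
  qed
  have "(\<Sum>i\<le>2 * k. \<Sum>l<d. t i l)
      = word_norm k d A1 + word_norm k d A2 - word_norm k d B - word_norm k d C"
    by (simp add: t_def word_norm_def sum.distrib sum_subtractf)
  also have "\<dots> = 0" using W norm by simp
  finally have "\<forall>i\<in>{..2 * k}. (\<Sum>l<d. t i l) = 0"
    using t_nonneg by (subst (asm) sum_nonneg_eq_0_iff) (auto intro!: sum_nonneg)
  then have t_0: "t i l = 0" if "i \<le> 2 * k" "l < d" for i l
    using that t_nonneg[OF that(1)] sum_nonneg_eq_0_iff[of "{..<d}" "t i"] by simp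
  have agree: "?v A1 i = ?v B i \<or> ?v A1 i = ?v C i" if "i \<le> 2 * k" for i
  proof (cases "i \<in> D")
    case True
    with D_swap show ?thesis by blast
  next
    case False
    have "poly (A1 l) (int i) = poly (B l) (int i)" if "l < d" for l
      using t_notD[OF \<open>i \<le> 2 * k\<close> False that] t_0[OF \<open>i \<le> 2 * k\<close> that] by simp
    then show ?thesis by (simp add: word_eval_eq_iff)
  qed
  define X Y where "X = {i. i \<le> 2 * k \<and> ?v A1 i = ?v B i}" "Y = {i. i \<le> 2 * k \<and> ?v A1 i = ?v C i}"
  have "X \<union> Y = {..2 * k}" using agree by (auto simp: X_Y_def)
  then have "2 * k + 1 \<le> card X + card Y" using card_Un_le[of X Y] by simp
  then have "k < card X \<or> k < card Y" by linarith
  moreover have "A1 = B" if "k < card X" using W that by (intro word_eqI[of A1 B X]) (auto simp: X_Y_def)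
  moreover have "A1 = C" if "k < card Y" using W that by (intro word_eqI[of A1 C Y]) (auto simp: X_Y_def)
  ultimately have "A1 = B \<or> A1 = C" by blast
  with dist E show False by auto
qed

end

section \<open>Counting words and vertices\<close>

definition coeff_box :: "nat \<Rightarrow> nat \<Rightarrow> int poly set" where
  "coeff_box k M = {p. degree p \<le> k \<and> (\<forall>j\<le>k. coeff p j \<in> {0..<int M})}"

lemma finite_coeff_box: "finite (coeff_box k M)"
  and card_coeff_box: "card (coeff_box k M) = M ^ (k + 1)"
proof -
  have "bij_betw (\<lambda>p. \<lambda>j\<in>{..k}. coeff p j) (coeff_box k M) ({..k} \<rightarrow>\<^sub>E {0..<int M})"
  proof (rule bij_betwI[where g = "\<lambda>c. \<Sum>j\<le>k. monom (c j) j"])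
    have coeff: "coeff (\<Sum>j\<le>k. monom (c j) j) i = (if i \<le> k then c i else 0)" for c :: "nat \<Rightarrow> int" and i
      by (simp add: coeff_sum coeff_monom)
    show "(\<lambda>p. \<lambda>j\<in>{..k}. coeff p j) \<in> coeff_box k M \<rightarrow> {..k} \<rightarrow>\<^sub>E {0..<int M}"
      by (auto simp: coeff_box_def)
    show "(\<lambda>c. \<Sum>j\<le>k. monom (c j) j) \<in> ({..k} \<rightarrow>\<^sub>E {0..<int M}) \<rightarrow> coeff_box k M"
      by (auto simp: coeff_box_def coeff PiE_iff intro!: degree_le)
    show "(\<Sum>j\<le>k. monom ((\<lambda>j\<in>{..k}. coeff p j) j) j) = p" if "p \<in> coeff_box k M" for p
      using that by (auto simp: poly_eq_iff coeff coeff_box_def coeff_eq_0)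
    show "(\<lambda>j\<in>{..k}. coeff (\<Sum>j\<le>k. monom (c j) j) j) = c" if "c \<in> {..k} \<rightarrow>\<^sub>E {0..<int M}" for c
      using that by (auto simp: coeff fun_eq_iff PiE_iff extensional_def)
  qed
  note bij = this
  show "finite (coeff_box k M)" using bij_betw_finite[OF bij] by (simp add: finite_PiE)
  show "card (coeff_box k M) = M ^ (k + 1)"
    using bij_betw_same_card[OF bij] by (simp add: card_PiE)
qed

text \<open>Bounds the values at \<open>i \<le> 2 * k\<close>: there are \<open>k + 1\<close> terms,
  each below \<open>M * (2 * k + 1) ^ k\<close>. The base \<open>2 * k + 1\<close> keeps powers
  monotone in the exponent even for \<open>k = 0\<close>.\<close>

definition eval_factor :: "nat \<Rightarrow> nat" where
  "eval_factor k = (k + 1) * (2 * k + 1) ^ k"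

lemma poly_coeff_box_bounds:
  assumes "p \<in> coeff_box k M" "i \<le> 2 * k"
  shows "0 \<le> poly p (int i)" and "poly p (int i) < int (eval_factor k * M)"
proof -
  have M: "M > 0" using assms(1) by (fastforce simp: coeff_box_def)
  have poly: "poly p (int i) = (\<Sum>j\<le>k. coeff p j * int i ^ j)"
    unfolding poly_altdef using assms(1)
    by (intro sum.mono_neutral_left) (auto simp: coeff_box_def coeff_eq_0)
  show "0 \<le> poly p (int i)" unfolding poly using assms(1) by (intro sum_nonneg) (auto simp: coeff_box_def)
  have "coeff p j * int i ^ j < int M * int (2 * k + 1) ^ k" if "j \<le> k" for j
  proof -
    have "int i ^ j \<le> int (2 * k + 1) ^ j" using assms(2) by (intro power_mono) auto
    also have "\<dots> \<le> int (2 * k + 1) ^ k" using that by (intro power_increasing) auto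
    finally have "coeff p j * int i ^ j \<le> coeff p j * int (2 * k + 1) ^ k"
      using assms(1) that by (intro mult_left_mono) (auto simp: coeff_box_def)
    also have "\<dots> < int M * int (2 * k + 1) ^ k"
      using assms(1) that by (intro mult_strict_right_mono) (auto simp: coeff_box_def)
    finally show ?thesis .
  qed
  then have "poly p (int i) < (\<Sum>j\<le>k. int M * int (2 * k + 1) ^ k)"
    unfolding poly by (intro sum_strict_mono) auto
  then show "poly p (int i) < int (eval_factor k * M)" by (simp add: eval_factor_def algebra_simps)
qed

text \<open>The left side of the conclusion counts all words, and the first factor on the right
  counts the admissible norms \<open>0, ..., m\<close>. The hypothesis makes room for all pairs of a
  position and a value vector.\<close>

lemma C2_lower_bound_box:
  assumes "(2 * k + 1) * (eval_factor k * M) ^ d \<le> n"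
  shows "M ^ (d * (k + 1)) \<le> ((2 * k + 1) * d * (eval_factor k * M)\<^sup>2 + 1) * C2 n (2 * k + 1)"
proof -
  define L where "L = eval_factor k * M"
  define U where "U = {..<d} \<rightarrow>\<^sub>E coeff_box k M"
  define m where "m = (2 * k + 1) * d * L\<^sup>2"
  have U_bounds: "0 \<le> poly (F l) (int i) \<and> poly (F l) (int i) < int L"
    if "F \<in> U" "i \<le> 2 * k" "l < d" for F i l
    using that poly_coeff_box_bounds[of "F l" k M i] by (auto simp: U_def L_def)
  have "word_norm k d ` U \<subseteq> {0..int m}"
  proof (intro image_subsetI, unfold atLeastAtMost_iff, intro conjI)
    fix F assume F: "F \<in> U"
    show "0 \<le> word_norm k d F" unfolding word_norm_def by (intro sum_nonneg) auto
    have "word_norm k d F \<le> (\<Sum>i\<le>2 * k. \<Sum>l<d. (int L)\<^sup>2)"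
      unfolding word_norm_def using U_bounds[OF F] by (intro sum_mono power_mono) (auto simp: less_imp_le)
    then show "word_norm k d F \<le> int m" by (simp add: m_def algebra_simps)
  qed
  moreover have "finite U" unfolding U_def by (intro finite_PiE) (auto simp: finite_coeff_box)
  ultimately obtain s where s: "card U \<le> card {0..int m} * card {F \<in> U. word_norm k d F = s}"
    using pigeonhole_fiber[of U "{0..int m}" "word_norm k d"] by auto
  define W where "W = {F \<in> U. word_norm k d F = s}"
  interpret poly_words k d W
    by unfold_locales (auto simp: W_def U_def PiE_iff coeff_box_def)
  define V where "V = {..2 * k} \<times> ({..<d} \<rightarrow>\<^sub>E {0..<int L})"
  have "card (word_edge k d ` W) \<le> C2 n (2 * k + 1)"
  proof (rule card_le_C2)
    show "two_cancellative (word_edge k d ` W)"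
      by (rule two_cancellative_word_edges[of s]) (simp add: W_def)
    show "e \<subseteq> V \<and> card e = 2 * k + 1" if "e \<in> word_edge k d ` W" for e
    proof -
      from that obtain F where F: "e = word_edge k d F" "F \<in> U" by (auto simp: W_def)
      have "word_eval d F i \<in> {..<d} \<rightarrow>\<^sub>E {0..<int L}" if "i \<le> 2 * k" for i
        unfolding word_eval_def using U_bounds[OF F(2) that] by auto
      then have "word_edge k d F \<subseteq> V" unfolding word_edge_def V_def by blast
      then show ?thesis using F(1) by (simp add: card_word_edge)
    qed
    show "finite V" unfolding V_def by (intro finite_cartesian_product finite_PiE) auto
    have "card V = (2 * k + 1) * L ^ d" by (simp add: V_def card_cartesian_product card_PiE)
    then show "card V \<le> n" using assms by (simp only: L_def)
  qed
  moreover have "card (word_edge k d ` W) = card W" by (rule card_image[OF inj_on_word_edge])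
  moreover have "card U = M ^ (d * (k + 1))"
    unfolding U_def by (simp only: card_PiE finite_lessThan card_coeff_box prod_constant card_lessThan
      power_mult[symmetric] mult.commute[of d])
  moreover have "card {0..int m} = m + 1" by simp
  ultimately have "M ^ (d * (k + 1)) \<le> (m + 1) * card W" "card W \<le> C2 n (2 * k + 1)"
    using s by (simp_all only: W_def)
  then have "M ^ (d * (k + 1)) \<le> (m + 1) * C2 n (2 * k + 1)"
    by (meson mult_le_mono2 le_trans)
  then show ?thesis by (simp only: m_def L_def)
qed

section \<open>Asymptotics\<close>

lemma C2_eventually_gt:
  assumes "\<delta> > 0"
  shows "\<forall>\<^sub>F n in sequentially. real n powr (real k + 1 - \<delta>) < real (C2 n (2 * k + 1))"
proof -
  \<comment> \<open>The norm classes cost \<open>2 / d\<close> in the exponent, so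
    \<open>d > 2 / \<delta>\<close> leaves a positive surplus. The added 2 also keeps the
    subtraction in \<open>e\<close> from truncating.\<close>
  define d where "d = nat \<lceil>2 / \<delta>\<rceil> + 2"
  have d2: "d \<ge> 2" by (simp add: d_def)
  have "2 / \<delta> < real d" unfolding d_def by linarith
  then have d_gap: "\<delta> - 2 / real d > 0" using assms d2 by (simp add: field_simps)
  define K where "K = eval_factor k"
  have K: "K > 0" by (simp add: K_def eval_factor_def)
  define R where "R = 2 * k + 1"
  \<comment> \<open>Chosen so that for \<open>y = a * real n powr (1 / real d)\<close> the
    \<open>d\<close>-th power of \<open>K * (2 * y)\<close> is exactly \<open>n / R\<close>; any
    \<open>M \<le> 2 * y\<close> then meets the vertex bound.\<close>
  define a where "a = (1 / real R) powr (1 / real d) / (2 * real K)"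
  have a: "a > 0" using K by (simp add: a_def R_def)
  define c where "c = real (R * d * K\<^sup>2 + 1)"
  have c: "c > 0" unfolding c_def by linarith
  define e where "e = d * (k + 1) - 2"
  have e: "d * (k + 1) = e + 2" using d2 by (simp add: e_def)
  have e_div: "real e / real d = real k + 1 - 2 / real d"
  proof -
    have "real d * (real k + 1) = real e + 2" using arg_cong[OF e, of real] by (simp add: algebra_simps)
    then show ?thesis using d2 by (simp add: field_simps)
  qed
  have "1 / real d > 0" using d2 by simp
  then have "\<forall>\<^sub>F n in sequentially. a * real n powr (1 / real d) \<ge> 1"
    using a by real_asymp
  moreover have "\<forall>\<^sub>F n in sequentially. real n powr (\<delta> - 2 / real d) > c / a ^ e"
    using d_gap by real_asymp
  ultimately show ?thesis using eventually_gt_at_top[of 0]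
  proof eventually_elim
    case (elim n)
    define y where "y = a * real n powr (1 / real d)"
    \<comment> \<open>Rounding down \<open>2 * y\<close> loses less than \<open>1 \<le> y\<close>,
      so \<open>M\<close> stays at least \<open>y\<close>.\<close>
    define M where "M = nat \<lfloor>2 * y\<rfloor>"
    have y: "y \<ge> 1" using elim by (simp add: y_def)
    have M: "y \<le> real M" "real M \<le> 2 * y" unfolding M_def using y by linarith+
    have "real (K * M) ^ d \<le> (real K * (2 * y)) ^ d"
      using M y by (intro power_mono) (auto intro: mult_left_mono)
    also have "real K * (2 * y) = (real n / real R) powr (1 / real d)"
      using K by (simp add: y_def a_def powr_divide)
    also have "\<dots> ^ d = real n / real R"
      using elim d2 by (simp add: powr_power R_def)
    finally have "real (R * (K * M) ^ d) \<le> real n" by (simp add: R_def field_simps)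
    then have "R * (K * M) ^ d \<le> n" by (simp only: of_nat_le_iff)
    then have "M ^ (e + 2) \<le> (R * d * (K * M)\<^sup>2 + 1) * C2 n (2 * k + 1)"
      using C2_lower_bound_box[of k M d n] e by (simp add: R_def K_def)
    also have "\<dots> \<le> ((R * d * K\<^sup>2 + 1) * M\<^sup>2) * C2 n (2 * k + 1)"
    proof (intro mult_right_mono)
      have "M\<^sup>2 \<ge> 1" using M y by simp
      then show "R * d * (K * M)\<^sup>2 + 1 \<le> (R * d * K\<^sup>2 + 1) * M\<^sup>2"
        by (simp add: power_mult_distrib algebra_simps)
    qed simp
    finally have "M\<^sup>2 * M ^ e \<le> M\<^sup>2 * ((R * d * K\<^sup>2 + 1) * C2 n (2 * k + 1))"
      by (simp only: power_add mult_ac)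
    moreover have "M > 0" using M y by simp
    ultimately have "M ^ e \<le> (R * d * K\<^sup>2 + 1) * C2 n (2 * k + 1)" by simp
    then have "real (M ^ e) \<le> c * real (C2 n (2 * k + 1))"
      unfolding c_def of_nat_mult[symmetric] of_nat_le_iff .
    moreover have "y ^ e \<le> real (M ^ e)" using M y by (simp add: power_mono)
    moreover have "y ^ e = a ^ e * real n powr (real k + 1 - 2 / real d)"
      using elim by (simp add: y_def power_mult_distrib powr_power flip: e_div)
    ultimately have "a ^ e * real n powr (real k + 1 - 2 / real d) \<le> c * real (C2 n (2 * k + 1))"
      by simp
    \<comment> \<open>The surplus factor \<open>real n powr (\<delta> - 2 / real d)\<close> exceeds
      \<open>c / a ^ e\<close> and so absorbs all constants.\<close>
    moreover have "real n powr (real k + 1 - 2 / real d)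
        = real n powr (\<delta> - 2 / real d) * real n powr (real k + 1 - \<delta>)"
      by (simp flip: powr_add)
    moreover have "c * real n powr (real k + 1 - \<delta>)
        < a ^ e * real n powr (\<delta> - 2 / real d) * real n powr (real k + 1 - \<delta>)"
      using elim a by (intro mult_strict_right_mono) (auto simp: field_simps)
    ultimately have "c * real n powr (real k + 1 - \<delta>) < c * real (C2 n (2 * k + 1))"
      by (simp add: mult_ac)
    then show ?case using c by simp
  qed
qed

theorem theorem2:
  fixes k :: nat
  assumes "k \<ge> 1"
  shows "\<exists>\<epsilon> :: nat \<Rightarrow> real. \<epsilon> \<longlonglongrightarrow> 0 \<and>
    (\<forall>\<^sub>F n in sequentially. real (C2 n (2 * k + 1)) > real n powr (real k + 1 - \<epsilon> n))"
proof -
  let ?C = "\<lambda>n. real (C2 n (2 * k + 1))"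
  \<comment> \<open>The exact shortfall of the exponent, clipped at 0 so that lower bounds on
    \<open>C2\<close> alone give the limit.\<close>
  define \<eta> where "\<eta> n = max 0 (real k + 1 - log (real n) (?C n))" for n
  have C_pos: "\<forall>\<^sub>F n in sequentially. ?C n > 0"
    using C2_eventually_gt[of 1 k, OF zero_less_one]
    by eventually_elim (rule le_less_trans[OF powr_ge_zero])
  have "\<eta> \<longlonglongrightarrow> 0"
  proof (rule order_tendstoI)
    show "\<forall>\<^sub>F n in sequentially. b < \<eta> n" if "b < 0" for b
      using that by (simp add: \<eta>_def less_max_iff_disj)
    show "\<forall>\<^sub>F n in sequentially. \<eta> n < b" if "b > 0" for b
      using C2_eventually_gt[OF that, of k] C_pos eventually_gt_at_top[of 1]
    proof eventually_elim
      case (elim n)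
      then have "real k + 1 - b < log (real n) (?C n)" by (simp add: less_log_iff)
      with that show ?case by (simp add: \<eta>_def)
    qed
  qed
  \<comment> \<open>The extra \<open>1 / real n\<close> turns the weak inequality given by
    \<open>\<eta>\<close> into a strict one.\<close>
  then have "(\<lambda>n. \<eta> n + 1 / real n) \<longlonglongrightarrow> 0"
    using tendsto_add[OF _ lim_1_over_n, of \<eta> 0] by simp
  moreover have "\<forall>\<^sub>F n in sequentially. ?C n > real n powr (real k + 1 - (\<eta> n + 1 / real n))"
    using C_pos eventually_gt_at_top[of 1]
  proof eventually_elim
    case (elim n)
    have "1 / real n > 0" using elim by simp
    then have "real k + 1 - (\<eta> n + 1 / real n) < log (real n) (?C n)" unfolding \<eta>_def by linarith
    with elim show ?case by (simp add: less_log_iff)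
  qed
  ultimately show ?thesis by blast
qed

end
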